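(* Fix a category $\mathbf{GMet}$ (i.e. a set $\mathcal H$ of Horn implications as in the context), the signature $\Sigma$ and a set $\Phi\subseteq\mathrm{GEq}$. For every $\phi\in\mathrm{GEq}$: if $\Phi\Vvdash\phi$ then $\Phi\vdash\phi$.
   Context: Fix a signature $\Sigma$: a set of operation symbols $op$, each with a finite arity $ar(op)\in\mathbb N$. For a set $A$, $\mathrm{Terms}_\Sigma(A)$ is the set of $\Sigma$-terms built from elements of $A$. A fuzzy relation space is a pair $(A,d_A)$ with $A$ a set and $d_A:A\times A\to[0,1]$; a map $f:(A,d_A)\to(B,d_B)$ is nonexpansive if $d_B(f(a),f(a'))\le d_A(a,a')$ for all $a,a'\in A$. Fix a set $\mathcal H$ of Horn implications $\forall\vec x.(F_1\wedge\dots\wedge F_n\Rightarrow G)$ whose atomic formulas have the form $x=y$ or $d(x,y)\le\epsilon$ ($\epsilon\in[0,1]$); $\mathbf{GMet}$ is the full subcategory of the category of fuzzy relation spaces and nonexpansive maps whose objects ($\mathbf{GMet}$ spaces) satisfy all implications in $\mathcal H$. A quantitative algebra is a triple $\mathbb A=(A,d_A,\{op^{\mathbb A}\}_{op\in\Sigma})$ with $(A,d_A)$ a $\mathbf{GMet}$ space and each $op^{\mathbb A}:A^{ar(op)}\to A$ an arbitrary function. An interpretation of a $\mathbf{GMet}$ space $(X,d_X)$ in $\mathbb A$ is a nonexpansive map $\tau:(X,d_X)\to(A,d_A)$; it extends to $[\![\cdot]\!]^{\mathbb A}_\tau:\mathrm{Terms}_\Sigma(X)\to A$ by $[\![x]\!]^{\mathbb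 A}_\tau=\tau(x)$ and $[\![op(t_1,\dots,t_n)]\!]^{\mathbb A}_\tau=op^{\mathbb A}([\![t_1]\!]^{\mathbb A}_\tau,\dots,[\![t_n]\!]^{\mathbb A}_\tau)$. A $\mathbf{GMet}$ equation is $\forall(X,d_X).\,s=t$ and a $\mathbf{GMet}$ quantitative equation is $\forall(X,d_X).\,s=_\epsilon t$, where $(X,d_X)$ is a $\mathbf{GMet}$ space, $s,t\in\mathrm{Terms}_\Sigma(X)$, $\epsilon\in[0,1]$; $\mathrm{GEq}$ is the set of all of these. $\mathbb A\models\forall(X,d_X).s=t$ iff $[\![s]\!]^{\mathbb A}_\tau=[\![t]\!]^{\mathbb A}_\tau$ for every nonexpansive $\tau$; $\mathbb A\models\forall(X,d_X).s=_\epsilon t$ iff $d_A([\![s]\!]^{\mathbb A}_\tau,[\![t]\!]^{\mathbb A}_\tau)\le\epsilon$ for every nonexpansive $\tau$. $\Phi\Vvdash\phi$ means every quantitative algebra satisfying all of $\Phi$ satisfies $\phi$. The relation $\vdash\subseteq\mathcal P(\mathrm{GEq})\times\mathrm{GEq}$ is the smallest relation such that: (INIT) $\Phi\vdash\phi$ whenever $\phi\in\Phi$; (CUT) if $\Phi\vdash\phi$ for all $\phi\in\Phi'$ and $\Phi\cup\Phi'\vdash\psi$, then $\Phi\vdash\psi$; (WEAKENING) if $\Phi\vdash\phi$ then $\Phi\cup\Phi'\vdash\phi$; and it contains all instances of the following schemes, for every $\mathbf{GMet}$ space $(A,d_A)$, terms $s,t,u,s_i,t_i\in\mathrm{Terms}_\Sigma(A)$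 and $\epsilon,\delta\in[0,1]$: (a) $\emptyset\vdash\forall(A,d_A).s=s$; (b) $\{\forall(A,d_A).s=t\}\vdash\forall(A,d_A).t=s$; (c) $\{\forall(A,d_A).s=t,\forall(A,d_A).t=u\}\vdash\forall(A,d_A).s=u$; (d) for $op$ of arity $n$, $\{\forall(A,d_A).s_i=t_i\}_{i=1}^n\vdash\forall(A,d_A).op(s_1,\dots,s_n)=op(t_1,\dots,t_n)$; (e) for $\mathbf{GMet}$ spaces $(A,d_A),(B,d_B)$ and any map $\sigma:A\to\mathrm{Terms}_\Sigma(B)$ (extended homomorphically to terms), with $\Psi=\{\forall(B,d_B).\sigma(a)=_{d_A(a,a')}\sigma(a')\mid a,a'\in A\}$: $\Psi\cup\{\forall(A,d_A).s=t\}\vdash\forall(B,d_B).\sigma(s)=\sigma(t)$ and $\Psi\cup\{\forall(A,d_A).s=_\epsilon t\}\vdash\forall(B,d_B).\sigma(s)=_\epsilon\sigma(t)$; (f) for $a,a'\in A$, $\emptyset\vdash\forall(A,d_A).a=_{d_A(a,a')}a'$; (g) for $\epsilon\le\delta$, $\{\forall(A,d_A).s=_\epsilon t\}\vdash\forall(A,d_A).s=_\delta t$; (h) $\emptyset\vdash\forall(A,d_A).s=_1t$; (i) for any index set $I$, $\{\forall(A,d_A).s=_{\epsilon_i}t\}_{i\in I}\vdash\forall(A,d_A).s=_{\inf_i\epsilon_i}t$; (j) $\{\forall(A,d_A).s=t,\forall(A,d_A).t=_\epsilon u\}\vdash\forall(A,d_A).s=_\epsilon u$ and $\{\forall(A,d_A).s=t,\forall(A,d_A).u=_\epsilon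 s\}\vdash\forall(A,d_A).u=_\epsilon t$; (k) for each implication $\forall X.(F_1\wedge\dots\wedge F_n\Rightarrow G)$ in $\mathcal H$ and each map $\sigma:X\to\mathrm{Terms}_\Sigma(A)$, $\{\phi_{F_1},\dots,\phi_{F_n}\}\vdash\phi_G$, where $\phi_F$ is $\forall(A,d_A).\sigma(x)=\sigma(y)$ if $F$ is $x=y$, and $\forall(A,d_A).\sigma(x)=_\epsilon\sigma(y)$ if $F$ is $d(x,y)\le\epsilon$. *)

theory Defs
  imports Complex_Main
begin

section \<open>Fuzzy relation spaces and GMet\<close>

definition fuzzy_space :: "'a set \<Rightarrow> ('a \<Rightarrow> 'a \<Rightarrow> real) \<Rightarrow> bool" where
  "fuzzy_space A d \<longleftrightarrow> (\<forall>a\<in>A. \<forall>a'\<in>A. d a a' \<in> {0..1})"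

definition nonexpansive ::
  "'a set \<Rightarrow> ('a \<Rightarrow> 'a \<Rightarrow> real) \<Rightarrow> 'b set \<Rightarrow> ('b \<Rightarrow> 'b \<Rightarrow> real) \<Rightarrow> ('a \<Rightarrow> 'b) \<Rightarrow> bool" where
  "nonexpansive A dA B dB f \<longleftrightarrow>
     (\<forall>a\<in>A. f a \<in> B) \<and> (\<forall>a\<in>A. \<forall>a'\<in>A. dB (f a) (f a') \<le> dA a a')"

text \<open>
  \<open>AEq x y\<close> is the atomic formula \<open>x = y\<close>, and \<open>ADist x y r\<close> is \<open>d(x,y) \<le> r\<close>.
  In \<open>Horn Fs G\<close> the variables occurring in \<open>Fs\<close> and \<open>G\<close> are universally quantified.
  Quantifying over further, non-occurring variables would not change anything: \<open>G\<close> always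
  contains a variable, so an assignment of the occurring ones always extends.
\<close>

datatype 'v atom = AEq 'v 'v | ADist 'v 'v real

datatype (horn_vars: 'v) horn = Horn "'v atom list" "'v atom"

primrec atom_wf :: "'v atom \<Rightarrow> bool" where
  "atom_wf (AEq x y) \<longleftrightarrow> True"
| "atom_wf (ADist x y r) \<longleftrightarrow> r \<in> {0..1}"

primrec horn_wf :: "'v horn \<Rightarrow> bool" where
  "horn_wf (Horn Fs G) \<longleftrightarrow> (\<forall>F\<in>set Fs. atom_wf F) \<and> atom_wf G"

primrec atom_holds :: "('a \<Rightarrow> 'a \<Rightarrow> real) \<Rightarrow> ('v \<Rightarrow> 'a) \<Rightarrow> 'v atom \<Rightarrow> bool" where
  "atom_holds d \<iota> (AEq x y) \<longleftrightarrow> \<iota> x = \<iota> y"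
| "atom_holds d \<iota> (ADist x y r) \<longleftrightarrow> d (\<iota> x) (\<iota> y) \<le> r"

primrec horn_body_holds :: "('a \<Rightarrow> 'a \<Rightarrow> real) \<Rightarrow> ('v \<Rightarrow> 'a) \<Rightarrow> 'v horn \<Rightarrow> bool" where
  "horn_body_holds d \<iota> (Horn Fs G) \<longleftrightarrow>
     ((\<forall>F\<in>set Fs. atom_holds d \<iota> F) \<longrightarrow> atom_holds d \<iota> G)"

definition horn_sat :: "'a set \<Rightarrow> ('a \<Rightarrow> 'a \<Rightarrow> real) \<Rightarrow> 'v horn \<Rightarrow> bool" where
  "horn_sat A d h \<longleftrightarrow>
     (\<forall>\<iota>. (\<forall>x\<in>horn_vars h. \<iota> x \<in> A) \<longrightarrow> horn_body_holds d \<iota> h)"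

definition gmet :: "'v horn set \<Rightarrow> 'a set \<Rightarrow> ('a \<Rightarrow> 'a \<Rightarrow> real) \<Rightarrow> bool" where
  "gmet H A d \<longleftrightarrow> fuzzy_space A d \<and> (\<forall>h\<in>H. horn_sat A d h)"


section \<open>Terms\<close>

text \<open>A signature is a set \<open>Sig\<close> of operation symbols with an arity function \<open>ar\<close>.\<close>

datatype ('f, 'x) trm = Var 'x | Op 'f "('f, 'x) trm list"

inductive_set terms :: "'f set \<Rightarrow> ('f \<Rightarrow> nat) \<Rightarrow> 'x set \<Rightarrow> ('f, 'x) trm set"
  for Sig ar A where
  Var: "x \<in> A \<Longrightarrow> Var x \<in> terms Sig ar A"
| Op: "f \<in> Sig \<Longrightarrow> length ts = ar f \<Longrightarrow> (\<And>t. t \<in> set ts \<Longrightarrow> t \<in> terms Sig ar A)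
       \<Longrightarrow> Op f ts \<in> terms Sig ar A"

primrec subst :: "('x \<Rightarrow> ('f, 'y) trm) \<Rightarrow> ('f, 'x) trm \<Rightarrow> ('f, 'y) trm" where
  "subst \<sigma> (Var x) = \<sigma> x"
| "subst \<sigma> (Op f ts) = Op f (map (subst \<sigma>) ts)"

primrec eval :: "('f \<Rightarrow> 'a list \<Rightarrow> 'a) \<Rightarrow> ('x \<Rightarrow> 'a) \<Rightarrow> ('f, 'x) trm \<Rightarrow> 'a" where
  "eval I \<tau> (Var x) = \<tau> x"
| "eval I \<tau> (Op f ts) = I f (map (eval I \<tau>) ts)"


section \<open>Quantitative algebras, GMet equations and semantic consequence\<close>

record ('f, 'a) qalg =
  qcarrier :: "'a set"
  qdist :: "'a \<Rightarrow> 'a \<Rightarrow> real"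
  qop :: "'f \<Rightarrow> 'a list \<Rightarrow> 'a"

definition quantitative_algebra ::
  "'v horn set \<Rightarrow> 'f set \<Rightarrow> ('f \<Rightarrow> nat) \<Rightarrow> ('f, 'a) qalg \<Rightarrow> bool" where
  "quantitative_algebra H Sig ar \<AA> \<longleftrightarrow>
     gmet H (qcarrier \<AA>) (qdist \<AA>) \<and>
     (\<forall>f\<in>Sig. \<forall>as. length as = ar f \<longrightarrow> set as \<subseteq> qcarrier \<AA> \<longrightarrow> qop \<AA> f as \<in> qcarrier \<AA>)"

text \<open>
  \<open>Eq A d s t\<close> stands for \<open>\<forall>(A,d). s = t\<close>, and \<open>QEq A d r s t\<close> for \<open>\<forall>(A,d). s =\<^sub>r t\<close>.
\<close>

datatype ('f, 'x) geq =
    Eq "'x set" "'x \<Rightarrow> 'x \<Rightarrow> real" "('f, 'x) trm" "('f, 'x) trm"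
  | QEq "'x set" "'x \<Rightarrow> 'x \<Rightarrow> real" real "('f, 'x) trm" "('f, 'x) trm"

primrec geq_wf :: "'v horn set \<Rightarrow> 'f set \<Rightarrow> ('f \<Rightarrow> nat) \<Rightarrow> ('f, 'x) geq \<Rightarrow> bool" where
  "geq_wf H Sig ar (Eq A d s t) \<longleftrightarrow>
     gmet H A d \<and> s \<in> terms Sig ar A \<and> t \<in> terms Sig ar A"
| "geq_wf H Sig ar (QEq A d r s t) \<longleftrightarrow>
     gmet H A d \<and> s \<in> terms Sig ar A \<and> t \<in> terms Sig ar A \<and> r \<in> {0..1}"

definition GEq :: "'v horn set \<Rightarrow> 'f set \<Rightarrow> ('f \<Rightarrow> nat) \<Rightarrow> ('f, 'x) geq set" where
  "GEq H Sig ar = {\<phi>. geq_wf H Sig ar \<phi>}"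

primrec models :: "('f, 'a) qalg \<Rightarrow> ('f, 'x) geq \<Rightarrow> bool" where
  "models \<AA> (Eq X d s t) \<longleftrightarrow>
     (\<forall>\<tau>. nonexpansive X d (qcarrier \<AA>) (qdist \<AA>) \<tau> \<longrightarrow>
          eval (qop \<AA>) \<tau> s = eval (qop \<AA>) \<tau> t)"
| "models \<AA> (QEq X d r s t) \<longleftrightarrow>
     (\<forall>\<tau>. nonexpansive X d (qcarrier \<AA>) (qdist \<AA>) \<tau> \<longrightarrow>
          qdist \<AA> (eval (qop \<AA>) \<tau> s) (eval (qop \<AA>) \<tau> t) \<le> r)"

text \<open>
  A HOL formula cannot quantify over algebras of all types, so semantic consequence is
  relative to a type \<open>'a\<close>, from which the carriers are drawn (as arbitrary subsets). Taken over
  all algebras of all types it implies this relation for every \<open>'a\<close>. Over a type that is too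
  small the relation is coarser: over a one-element type, for instance, all equations hold.
  Completeness is therefore only meaningful when \<open>'a\<close> has room for the \<open>Sig\<close>-terms.
\<close>

definition entails ::
  "'a itself \<Rightarrow> 'v horn set \<Rightarrow> 'f set \<Rightarrow> ('f \<Rightarrow> nat) \<Rightarrow> ('f, 'x) geq set \<Rightarrow> ('f, 'x) geq \<Rightarrow> bool" where
  "entails (_ :: 'a itself) H Sig ar \<Phi> \<phi> \<longleftrightarrow>
     (\<forall>\<AA> :: ('f, 'a) qalg. quantitative_algebra H Sig ar \<AA> \<longrightarrow>
        (\<forall>\<psi>\<in>\<Phi>. models \<AA> \<psi>) \<longrightarrow> models \<AA> \<phi>)"


section \<open>The deductive system\<close>

text \<open>The infimum in \<open>[0,1]\<close>; the empty set has infimum 1, which \<open>Inf\<close> on the reals does not give.\<close>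

definition inf01 :: "real set \<Rightarrow> real" where
  "inf01 E = (if E = {} then 1 else Inf E)"

primrec atom_geq ::
  "'x set \<Rightarrow> ('x \<Rightarrow> 'x \<Rightarrow> real) \<Rightarrow> ('v \<Rightarrow> ('f, 'x) trm) \<Rightarrow> 'v atom \<Rightarrow> ('f, 'x) geq" where
  "atom_geq A d \<sigma> (AEq x y) = Eq A d (\<sigma> x) (\<sigma> y)"
| "atom_geq A d \<sigma> (ADist x y r) = QEq A d r (\<sigma> x) (\<sigma> y)"

definition subst_prems ::
  "'x set \<Rightarrow> ('x \<Rightarrow> 'x \<Rightarrow> real) \<Rightarrow> 'y set \<Rightarrow> ('y \<Rightarrow> 'y \<Rightarrow> real) \<Rightarrow> ('x \<Rightarrow> ('f, 'y) trm) \<Rightarrow> ('f, 'y) geq set" where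
  "subst_prems A dA B dB \<sigma> = {QEq B dB (dA a a') (\<sigma> a) (\<sigma> a') | a a'. a \<in> A \<and> a' \<in> A}"

text \<open>
  In rule \<open>inf\<close>, a family indexed by \<open>I\<close> enters only through its set \<open>E\<close> of values, because
  the premises form a set.
\<close>

inductive derives ::
  "'v horn set \<Rightarrow> 'f set \<Rightarrow> ('f \<Rightarrow> nat) \<Rightarrow> ('f, 'x) geq set \<Rightarrow> ('f, 'x) geq \<Rightarrow> bool"
  for H :: "'v horn set" and Sig :: "'f set" and ar :: "'f \<Rightarrow> nat" where
  init: "\<lbrakk>\<Phi> \<subseteq> GEq H Sig ar; \<phi> \<in> \<Phi>\<rbrakk> \<Longrightarrow> derives H Sig ar \<Phi> \<phi>"
| cut: "\<lbrakk>\<And>\<phi>. \<phi> \<in> \<Phi>' \<Longrightarrow> derives H Sig ar \<Phi> \<phi>; derives H Sig ar (\<Phi> \<union> \<Phi>') \<psi>\<rbrakk>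
    \<Longrightarrow> derives H Sig ar \<Phi> \<psi>"
| weakening: "\<lbrakk>derives H Sig ar \<Phi> \<phi>; \<Phi>' \<subseteq> GEq H Sig ar\<rbrakk> \<Longrightarrow> derives H Sig ar (\<Phi> \<union> \<Phi>') \<phi>"
| refl: "\<lbrakk>gmet H A d; s \<in> terms Sig ar A\<rbrakk> \<Longrightarrow> derives H Sig ar {} (Eq A d s s)"
| sym: "\<lbrakk>gmet H A d; s \<in> terms Sig ar A; t \<in> terms Sig ar A\<rbrakk>
    \<Longrightarrow> derives H Sig ar {Eq A d s t} (Eq A d t s)"
| trans: "\<lbrakk>gmet H A d; s \<in> terms Sig ar A; t \<in> terms Sig ar A; u \<in> terms Sig ar A\<rbrakk>
    \<Longrightarrow> derives H Sig ar {Eq A d s t, Eq A d t u} (Eq A d s u)"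
| cong: "\<lbrakk>gmet H A d; f \<in> Sig; length ss = ar f; length ts = ar f;
      set ss \<subseteq> terms Sig ar A; set ts \<subseteq> terms Sig ar A\<rbrakk>
    \<Longrightarrow> derives H Sig ar {Eq A d (ss ! i) (ts ! i) | i. i < ar f} (Eq A d (Op f ss) (Op f ts))"
| subst_eq: "\<lbrakk>gmet H A dA; gmet H B dB; \<forall>a\<in>A. \<sigma> a \<in> terms Sig ar B;
      s \<in> terms Sig ar A; t \<in> terms Sig ar A\<rbrakk>
    \<Longrightarrow> derives H Sig ar (subst_prems A dA B dB \<sigma> \<union> {Eq A dA s t})
          (Eq B dB (subst \<sigma> s) (subst \<sigma> t))"
| subst_qeq: "\<lbrakk>gmet H A dA; gmet H B dB; \<forall>a\<in>A. \<sigma> a \<in> terms Sig ar B;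
      s \<in> terms Sig ar A; t \<in> terms Sig ar A; r \<in> {0..1}\<rbrakk>
    \<Longrightarrow> derives H Sig ar (subst_prems A dA B dB \<sigma> \<union> {QEq A dA r s t})
          (QEq B dB r (subst \<sigma> s) (subst \<sigma> t))"
| var: "\<lbrakk>gmet H A d; a \<in> A; a' \<in> A\<rbrakk>
    \<Longrightarrow> derives H Sig ar {} (QEq A d (d a a') (Var a) (Var a'))"
| mono: "\<lbrakk>gmet H A d; s \<in> terms Sig ar A; t \<in> terms Sig ar A;
      r \<in> {0..1}; q \<in> {0..1}; r \<le> q\<rbrakk>
    \<Longrightarrow> derives H Sig ar {QEq A d r s t} (QEq A d q s t)"
| one: "\<lbrakk>gmet H A d; s \<in> terms Sig ar A; t \<in> terms Sig ar A\<rbrakk>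
    \<Longrightarrow> derives H Sig ar {} (QEq A d 1 s t)"
| inf: "\<lbrakk>gmet H A d; s \<in> terms Sig ar A; t \<in> terms Sig ar A; E \<subseteq> {0..1}\<rbrakk>
    \<Longrightarrow> derives H Sig ar {QEq A d r s t | r. r \<in> E} (QEq A d (inf01 E) s t)"
| compat_left: "\<lbrakk>gmet H A d; s \<in> terms Sig ar A; t \<in> terms Sig ar A; u \<in> terms Sig ar A; r \<in> {0..1}\<rbrakk>
    \<Longrightarrow> derives H Sig ar {Eq A d s t, QEq A d r t u} (QEq A d r s u)"
| compat_right: "\<lbrakk>gmet H A d; s \<in> terms Sig ar A; t \<in> terms Sig ar A; u \<in> terms Sig ar A; r \<in> {0..1}\<rbrakk>
    \<Longrightarrow> derives H Sig ar {Eq A d s t, QEq A d r u s} (QEq A d r u t)"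
| horn: "\<lbrakk>gmet H A d; Horn Fs G \<in> H; \<forall>x\<in>horn_vars (Horn Fs G). \<sigma> x \<in> terms Sig ar A\<rbrakk>
    \<Longrightarrow> derives H Sig ar (atom_geq A d \<sigma> ` set Fs) (atom_geq A d \<sigma> G)"

end

theory Submission
  imports Defs
begin

text \<open>
  The model refuting an underivable equation over \<open>(X, d)\<close> is the algebra of terms over \<open>X\<close> modulo
  derivable equality, with the distance of \<open>s\<close> and \<open>t\<close> being the least \<open>r\<close> for which \<open>s =\<^sub>r t\<close> is
  derivable; the rules \<open>inf\<close> and \<open>one\<close> make this minimum exist. A nonexpansive map from \<open>(Y, d')\<close>
  into it is a substitution whose premises in the substitution rules are derivable, so those rules
  make the algebra a model of \<open>\<Phi>\<close>. Conversely, by rule \<open>var\<close> the variables form a nonexpansive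
  interpretation of \<open>(X, d)\<close>, under which every term denotes its own class.
\<close>

lemma subst_in_terms:
  assumes "t \<in> terms Sig ar A" "\<And>a. a \<in> A \<Longrightarrow> \<sigma> a \<in> terms Sig ar B"
  shows "subst \<sigma> t \<in> terms Sig ar B"
  using assms(1) by induction (auto intro!: terms.Op simp: assms(2))

lemma subst_Var: "subst Var t = t"
  by (induction t) (auto intro: map_idI)

lemma terms_mono: "A \<subseteq> B \<Longrightarrow> terms Sig ar A \<subseteq> terms Sig ar B"
proof
  fix t assume "A \<subseteq> B" "t \<in> terms Sig ar A"
  from this(2,1) show "t \<in> terms Sig ar B"
    by induction (auto intro: terms.intros)
qed

text \<open>Weakening makes the rule instance available under \<open>\<Phi>\<close>, and cut then
  discharges its premises. In this form each axiom scheme acts as a closure property of the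
  consequences of \<open>\<Phi>\<close>.\<close>

lemma derives_cut_subset:
  assumes "derives H Sig ar \<Psi> \<phi>" "\<Phi> \<subseteq> GEq H Sig ar" "\<And>\<psi>. \<psi> \<in> \<Psi> \<Longrightarrow> derives H Sig ar \<Phi> \<psi>"
  shows "derives H Sig ar \<Phi> \<phi>"
  using derives.cut[OF assms(3)] derives.weakening[OF assms(1,2)] by (simp add: Un_commute)

text \<open>Since \<open>entails\<close> sees only algebras with carrier in \<open>'a\<close>, the
  term algebra has to be moved there; \<open>e\<close> transports it.\<close>

locale term_model =
  fixes H :: "'v horn set" and Sig :: "'f set" and ar :: "'f \<Rightarrow> nat"
    and \<Phi> :: "('f, 'x) geq set" and X :: "'x set" and d :: "'x \<Rightarrow> 'x \<Rightarrow> real"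
    and e :: "('f, 'x) trm \<Rightarrow> 'a"
  assumes H_wf: "\<forall>h\<in>H. horn_wf h"
    and \<Phi>: "\<Phi> \<subseteq> GEq H Sig ar"
    and X: "gmet H X d"
    and inj_e: "inj_on e (terms Sig ar X)"
begin

abbreviation T :: "('f, 'x) trm set" where "T \<equiv> terms Sig ar X"

abbreviation D :: "('f, 'x) geq \<Rightarrow> bool" where "D \<equiv> derives H Sig ar \<Phi>"

abbreviation eqv (infix \<open>\<approx>\<close> 50) where "s \<approx> t \<equiv> D (Eq X d s t)"

lemmas cut = derives_cut_subset[OF _ \<Phi>]

section \<open>Derivable equality as a congruence\<close>

lemma eqv_refl: "s \<in> T \<Longrightarrow> s \<approx> s"
  using derives.refl[OF X] by (rule cut) auto

lemma eqv_sym: "s \<approx> t \<Longrightarrow> s \<in> T \<Longrightarrow> t \<in> T \<Longrightarrow> t \<approx> s"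
  using derives.sym[OF X] by (rule cut) auto

lemma eqv_trans: "s \<approx> t \<Longrightarrow> t \<approx> u \<Longrightarrow> s \<in> T \<Longrightarrow> t \<in> T \<Longrightarrow> u \<in> T \<Longrightarrow> s \<approx> u"
  by (rule cut[OF derives.trans[OF X, where t = t]]) auto

lemma eqv_Op:
  assumes "f \<in> Sig" "length ss = ar f" "length ts = ar f" "set ss \<subseteq> T" "set ts \<subseteq> T"
    and "\<And>i. i < ar f \<Longrightarrow> ss ! i \<approx> ts ! i"
  shows "Op f ss \<approx> Op f ts"
  using derives.cong[OF X assms(1-5)] by (rule cut) (use assms(6) in auto)

lemma qeq_cong:
  assumes st: "D (QEq X d r s t)" and r: "r \<in> {0..1}" and "s \<approx> s'" "t \<approx> t'"
    and T: "s \<in> T" "t \<in> T" "s' \<in> T" "t' \<in> T"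
  shows "D (QEq X d r s' t')"
proof -
  \<comment> \<open>\<open>compat_left\<close> rewrites against the direction of its equation,
    \<open>compat_right\<close> along it; hence only the left side needs symmetry.\<close>
  have "s' \<approx> s"
    using assms eqv_sym by blast
  then have "D (QEq X d r s' t)"
    using st by (intro cut[OF derives.compat_left[OF X T(3,1,2) r]]) auto
  then show ?thesis
    using \<open>t \<approx> t'\<close> by (intro cut[OF derives.compat_right[OF X T(2,4,3) r]]) auto
qed

text \<open>A class is coded by the image of one chosen member, because the embedding
  \<open>e\<close> is given for single terms, not for sets of them. The choice predicate depends on
  \<open>t\<close> only up to derivable equality, so equivalent terms receive the same code.\<close>

definition cls :: "('f, 'x) trm \<Rightarrow> 'a" where
  "cls t = e (SOME s. s \<in> T \<and> t \<approx> s)"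

definition term_of :: "'a \<Rightarrow> ('f, 'x) trm" where
  "term_of x = inv_into T e x"

lemma term_of_cls:
  assumes "t \<in> T"
  shows "term_of (cls t) \<in> T \<and> t \<approx> term_of (cls t)"
proof -
  let ?s = "SOME s. s \<in> T \<and> t \<approx> s"
  have "?s \<in> T \<and> t \<approx> ?s"
    by (rule someI[of _ t]) (use assms eqv_refl in auto)
  then show ?thesis
    by (simp add: term_of_def cls_def inj_e)
qed

lemma cls_eq_iff:
  assumes "s \<in> T" "t \<in> T"
  shows "cls s = cls t \<longleftrightarrow> s \<approx> t"
proof
  assume "cls s = cls t"
  then show "s \<approx> t"
    using term_of_cls[of s] term_of_cls[of t] assms by (metis eqv_sym eqv_trans)
next
  assume "s \<approx> t"
  then have "s' \<in> T \<and> s \<approx> s' \<longleftrightarrow> s' \<in> T \<and> t \<approx> s'" for s'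
    using assms by (metis eqv_sym eqv_trans)
  then show "cls s = cls t"
    by (simp add: cls_def)
qed

lemma cls_term_of: "x \<in> cls ` T \<Longrightarrow> term_of x \<in> T \<and> cls (term_of x) = x"
  using term_of_cls cls_eq_iff by fastforce

section \<open>The least derivable distance bound\<close>

definition tdist :: "('f, 'x) trm \<Rightarrow> ('f, 'x) trm \<Rightarrow> real" where
  "tdist s t = Inf {r \<in> {0..1}. D (QEq X d r s t)}"

lemma tdist:
  assumes "s \<in> T" "t \<in> T"
  shows tdist_range: "tdist s t \<in> {0..1}"
    and tdist_le_iff: "r \<in> {0..1} \<Longrightarrow> tdist s t \<le> r \<longleftrightarrow> D (QEq X d r s t)"
proof -
  let ?E = "{r \<in> {0..1}. D (QEq X d r s t)}"
  have "D (QEq X d 1 s t)"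
    using derives.one[OF X assms] by (rule cut) auto
  then have 1: "1 \<in> ?E"
    by simp
  have bdd: "bdd_below ?E"
    by (rule bdd_belowI[of _ 0]) auto
  show range: "tdist s t \<in> {0..1}"
  proof -
    have "0 \<le> tdist s t"
      unfolding tdist_def using 1 by (intro cInf_greatest) auto
    moreover have "tdist s t \<le> 1"
      unfolding tdist_def by (rule cInf_lower[OF 1 bdd])
    ultimately show ?thesis
      by simp
  qed
  \<comment> \<open>Rule \<open>inf\<close> is applied to the set of all derivable bounds, so its
    premises hold by construction. As this set contains 1, the default of \<open>inf01\<close> is
    avoided and the infimum is attained.\<close>
  have "D (QEq X d (inf01 ?E) s t)"
    by (rule cut[OF derives.inf[OF X assms]]) auto
  moreover have "inf01 ?E = tdist s t"
    using 1 by (auto simp: inf01_def tdist_def)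
  ultimately have attained: "D (QEq X d (tdist s t) s t)"
    by simp
  show "tdist s t \<le> r \<longleftrightarrow> D (QEq X d r s t)" if r: "r \<in> {0..1}"
  proof
    assume "tdist s t \<le> r"
    from derives.mono[OF X assms range r this] show "D (QEq X d r s t)"
      by (rule cut) (use attained in auto)
  next
    assume "D (QEq X d r s t)"
    then show "tdist s t \<le> r"
      unfolding tdist_def using r bdd by (intro cInf_lower) auto
  qed
qed

text \<open>By \<open>qeq_cong\<close> in both directions the two pairs have the same derivable
  bounds, hence the same infimum. This makes the distance a function of classes.\<close>

lemma tdist_cong:
  assumes "s \<approx> s'" "t \<approx> t'" "s \<in> T" "t \<in> T" "s' \<in> T" "t' \<in> T"
  shows "tdist s t = tdist s' t'"
proof -
  have "r \<in> {0..1} \<and> D (QEq X d r s t) \<longleftrightarrow> r \<in> {0..1} \<and> D (QEq X d r s' t')" for r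
    using assms qeq_cong[of r s t s' t'] qeq_cong[of r s' t' s t] eqv_sym by blast
  then show ?thesis
    by (simp add: tdist_def)
qed

section \<open>The algebra of term classes\<close>

definition \<AA> :: "('f, 'a) qalg" where
  "\<AA> = \<lparr>qcarrier = cls ` T,
        qdist = (\<lambda>x y. tdist (term_of x) (term_of y)),
        qop = (\<lambda>f xs. cls (Op f (map term_of xs)))\<rparr>"

lemma \<AA>_simps [simp]:
  "qcarrier \<AA> = cls ` T"
  "qdist \<AA> x y = tdist (term_of x) (term_of y)"
  by (simp_all add: \<AA>_def)

lemma qop_\<AA>: "qop \<AA> f xs = cls (Op f (map term_of xs))"
  by (simp add: \<AA>_def)

lemma tdist_term_of_cls:
  "s \<in> T \<Longrightarrow> t \<in> T \<Longrightarrow> tdist (term_of (cls s)) (term_of (cls t)) = tdist s t"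
  using term_of_cls by (metis tdist_cong)

text \<open>Truth of an atom in the algebra becomes derivability of its term instance:
  \<open>cls_eq_iff\<close> handles equations, \<open>tdist_le_iff\<close> distances.
  Well-formedness places the bound in the unit interval, where \<open>tdist_le_iff\<close>
  applies.\<close>

lemma atom_holds_iff:
  assumes "atom_wf F" "\<forall>x\<in>set_atom F. \<iota> x \<in> cls ` T"
  shows "atom_holds (qdist \<AA>) \<iota> F \<longleftrightarrow> D (atom_geq X d (term_of \<circ> \<iota>) F)"
proof (cases F)
  case (AEq x y)
  then have x: "\<iota> x \<in> cls ` T" and y: "\<iota> y \<in> cls ` T"
    using assms by auto
  show ?thesis
    using cls_eq_iff[of "term_of (\<iota> x)" "term_of (\<iota> y)"] cls_term_of[OF x] cls_term_of[OF y]
    by (simp add: AEq)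
next
  case (ADist x y r)
  then have x: "\<iota> x \<in> cls ` T" and y: "\<iota> y \<in> cls ` T" and r: "r \<in> {0..1}"
    using assms by auto
  show ?thesis
    using tdist_le_iff[OF _ _ r] cls_term_of[OF x] cls_term_of[OF y] by (simp add: ADist)
qed

text \<open>Composed with \<open>term_of\<close>, an assignment into the carrier is a substitution
  into \<open>T\<close>. Rule \<open>horn\<close> for this substitution, read through
  \<open>atom_holds_iff\<close>, is the implication itself.\<close>

lemma \<AA>_horn_sat:
  assumes "h \<in> H"
  shows "horn_sat (qcarrier \<AA>) (qdist \<AA>) h"
  unfolding horn_sat_def
proof (intro allI impI)
  fix \<iota> assume \<iota>: "\<forall>x\<in>horn_vars h. \<iota> x \<in> qcarrier \<AA>"
  obtain Fs G where h: "h = Horn Fs G"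
    by (cases h)
  have holds: "atom_holds (qdist \<AA>) \<iota> F \<longleftrightarrow> D (atom_geq X d (term_of \<circ> \<iota>) F)"
    if "F \<in> insert G (set Fs)" for F
    using that H_wf assms \<iota> h by (intro atom_holds_iff) auto
  have "\<forall>x\<in>horn_vars (Horn Fs G). (term_of \<circ> \<iota>) x \<in> T"
    using \<iota> h cls_term_of by (metis \<AA>_simps(1) comp_apply)
  then have horn: "derives H Sig ar (atom_geq X d (term_of \<circ> \<iota>) ` set Fs)
                     (atom_geq X d (term_of \<circ> \<iota>) G)"
    using derives.horn[OF X] assms h by blast
  have "atom_holds (qdist \<AA>) \<iota> G" if "\<forall>F\<in>set Fs. atom_holds (qdist \<AA>) \<iota> F"
    using cut[OF horn] that holds by blast
  then show "horn_body_holds (qdist \<AA>) \<iota> h"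
    by (simp add: h)
qed

lemma \<AA>_quantitative_algebra: "quantitative_algebra H Sig ar \<AA>"
proof -
  have "fuzzy_space (qcarrier \<AA>) (qdist \<AA>)"
    using cls_term_of tdist_range by (simp only: fuzzy_space_def \<AA>_simps) blast
  moreover have "qop \<AA> f xs \<in> qcarrier \<AA>"
    if "f \<in> Sig" "length xs = ar f" "set xs \<subseteq> qcarrier \<AA>" for f xs
  proof -
    have "term_of x \<in> T" if "x \<in> set xs" for x
      using that \<open>set xs \<subseteq> qcarrier \<AA>\<close> cls_term_of by auto
    then show ?thesis
      using that by (auto simp: qop_\<AA> intro!: imageI terms.Op)
  qed
  ultimately show ?thesis
    using \<AA>_horn_sat by (auto simp: quantitative_algebra_def gmet_def)
qed

text \<open>Here \<open>\<sigma>\<close> may be any choice of representatives for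
  \<open>\<tau>\<close>: \<open>term_of \<circ> \<tau>\<close> serves for arbitrary interpretations,
  \<open>Var\<close> for the interpretation by classes of variables.\<close>

lemma eval_\<AA>:
  assumes "t \<in> terms Sig ar Y" and \<sigma>: "\<And>a. a \<in> Y \<Longrightarrow> \<sigma> a \<in> T \<and> cls (\<sigma> a) = \<tau> a"
  shows "eval (qop \<AA>) \<tau> t = cls (subst \<sigma> t)"
  using assms(1)
proof induction
  case (Var x)
  then show ?case
    using \<sigma> by simp
next
  case (Op f ts)
  have T: "subst \<sigma> t \<in> T" if "t \<in> set ts" for t
    using that Op \<sigma> by (blast intro: subst_in_terms)
  let ?ss = "map (\<lambda>t. term_of (cls (subst \<sigma> t))) ts"
  have "map term_of (map (eval (qop \<AA>) \<tau>) ts) = ?ss"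
    by (simp add: Op.IH)
  then have "eval (qop \<AA>) \<tau> (Op f ts) = cls (Op f ?ss)"
    unfolding eval.simps qop_\<AA>[of f] by (simp only:)
  \<comment> \<open>The operation works on the representatives picked by \<open>term_of\<close>,
    which may differ from the substituted arguments; congruence absorbs the difference.\<close>
  moreover have "Op f ?ss \<approx> Op f (map (subst \<sigma>) ts)"
    using Op.hyps T term_of_cls eqv_sym by (intro eqv_Op) auto
  then have "cls (Op f ?ss) = cls (Op f (map (subst \<sigma>) ts))"
    using Op.hyps T term_of_cls by (subst cls_eq_iff) (auto intro!: terms.Op)
  ultimately show ?case
    by simp
qed

section \<open>Interpretations as substitutions; validity of \<open>\<Phi>\<close>\<close>

lemma term_of_interpretation:
  assumes "nonexpansive Y d' (qcarrier \<AA>) (qdist \<AA>) \<tau>" "a \<in> Y"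
  shows "(term_of \<circ> \<tau>) a \<in> T \<and> cls ((term_of \<circ> \<tau>) a) = \<tau> a"
  using assms cls_term_of by (auto simp: nonexpansive_def)

lemma eval_interpretation:
  assumes "nonexpansive Y d' (qcarrier \<AA>) (qdist \<AA>) \<tau>" "t \<in> terms Sig ar Y"
  shows "eval (qop \<AA>) \<tau> t = cls (subst (term_of \<circ> \<tau>) t)"
  using assms(2) term_of_interpretation[OF assms(1)] by (rule eval_\<AA>)

lemma subst_prems_interpretation:
  assumes "gmet H Y d'" and ne: "nonexpansive Y d' (qcarrier \<AA>) (qdist \<AA>) \<tau>"
    and "\<chi> \<in> subst_prems Y d' X d (term_of \<circ> \<tau>)"
  shows "D \<chi>"
proof -
  obtain a b where ab: "a \<in> Y" "b \<in> Y"
    and \<chi>: "\<chi> = QEq X d (d' a b) ((term_of \<circ> \<tau>) a) ((term_of \<circ> \<tau>) b)"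
    using assms(3) by (auto simp: subst_prems_def)
  \<comment> \<open>This range condition allows \<open>tdist_le_iff\<close> to turn the
    nonexpansiveness inequality into a derivation.\<close>
  have "d' a b \<in> {0..1}"
    using assms(1) ab by (auto simp: gmet_def fuzzy_space_def)
  moreover have "tdist ((term_of \<circ> \<tau>) a) ((term_of \<circ> \<tau>) b) \<le> d' a b"
    using ne ab by (auto simp: nonexpansive_def)
  ultimately show "D \<chi>"
    using term_of_interpretation[OF ne] ab tdist_le_iff \<chi> by blast
qed

lemma \<AA>_models:
  assumes "\<psi> \<in> \<Phi>"
  shows "models \<AA> \<psi>"
proof -
  have wf: "geq_wf H Sig ar \<psi>"
    using assms \<Phi> by (auto simp: GEq_def)
  have D\<psi>: "D \<psi>"
    using derives.init[OF \<Phi> assms] .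
  show ?thesis
  proof (cases \<psi>)
    case (Eq Y d' s t)
    have "eval (qop \<AA>) \<tau> s = eval (qop \<AA>) \<tau> t"
      if ne: "nonexpansive Y d' (qcarrier \<AA>) (qdist \<AA>) \<tau>" for \<tau>
    proof -
      let ?\<sigma> = "term_of \<circ> \<tau>"
      have Y: "gmet H Y d'" and st: "s \<in> terms Sig ar Y" "t \<in> terms Sig ar Y"
        using wf Eq by auto
      have "subst ?\<sigma> s \<approx> subst ?\<sigma> t"
        by (rule cut[OF derives.subst_eq[OF Y X _ st]])
          (use term_of_interpretation[OF ne] subst_prems_interpretation[OF Y ne] D\<psi> Eq in auto)
      moreover have "subst ?\<sigma> s \<in> T" "subst ?\<sigma> t \<in> T"
        using st term_of_interpretation[OF ne] by (blast intro: subst_in_terms)+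
      ultimately show ?thesis
        using eval_interpretation[OF ne] st cls_eq_iff by simp
    qed
    then show ?thesis
      by (simp add: Eq)
  next
    case (QEq Y d' r s t)
    have "qdist \<AA> (eval (qop \<AA>) \<tau> s) (eval (qop \<AA>) \<tau> t) \<le> r"
      if ne: "nonexpansive Y d' (qcarrier \<AA>) (qdist \<AA>) \<tau>" for \<tau>
    proof -
      let ?\<sigma> = "term_of \<circ> \<tau>"
      have Y: "gmet H Y d'" and st: "s \<in> terms Sig ar Y" "t \<in> terms Sig ar Y" and r: "r \<in> {0..1}"
        using wf QEq by auto
      have "D (QEq X d r (subst ?\<sigma> s) (subst ?\<sigma> t))"
        by (rule cut[OF derives.subst_qeq[OF Y X _ st r]])
          (use term_of_interpretation[OF ne] subst_prems_interpretation[OF Y ne] D\<psi> QEq in auto)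
      moreover have "subst ?\<sigma> s \<in> T" "subst ?\<sigma> t \<in> T"
        using st term_of_interpretation[OF ne] by (blast intro: subst_in_terms)+
      ultimately show ?thesis
        using eval_interpretation[OF ne] st r
        by (simp add: tdist_term_of_cls tdist_le_iff del: atLeastAtMost_iff)
    qed
    then show ?thesis
      by (simp add: QEq)
  qed
qed

section \<open>From validity under the interpretation by variables back to derivability\<close>

lemma nonexpansive_cls_Var: "nonexpansive X d (qcarrier \<AA>) (qdist \<AA>) (cls \<circ> Var)"
proof -
  have "qdist \<AA> (cls (Var a)) (cls (Var b)) \<le> d a b" if "a \<in> X" "b \<in> X" for a b
  proof -
    have "D (QEq X d (d a b) (Var a) (Var b))"
      using derives.var[OF X that] by (rule cut) auto
    moreover have "d a b \<in> {0..1}"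
      using X that by (auto simp: gmet_def fuzzy_space_def)
    ultimately show ?thesis
      using that by (simp add: tdist_term_of_cls tdist_le_iff terms.Var del: atLeastAtMost_iff)
  qed
  then show ?thesis
    by (auto simp: nonexpansive_def terms.Var)
qed

lemma eval_cls_Var: "t \<in> T \<Longrightarrow> eval (qop \<AA>) (cls \<circ> Var) t = cls t"
  using eval_\<AA>[of t X Var "cls \<circ> Var"] by (simp add: subst_Var terms.Var)

lemma models_Eq_derives: "models \<AA> (Eq X d s t) \<Longrightarrow> s \<in> T \<Longrightarrow> t \<in> T \<Longrightarrow> D (Eq X d s t)"
  using nonexpansive_cls_Var eval_cls_Var cls_eq_iff by (metis models.simps(1))

lemma models_QEq_derives:
  assumes "models \<AA> (QEq X d r s t)" "s \<in> T" "t \<in> T" "r \<in> {0..1}"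
  shows "D (QEq X d r s t)"
proof -
  have "qdist \<AA> (cls s) (cls t) \<le> r"
    using assms nonexpansive_cls_Var eval_cls_Var by (metis models.simps(2))
  then show ?thesis
    using assms by (simp add: tdist_term_of_cls tdist_le_iff del: atLeastAtMost_iff)
qed

end

theorem mainTheorem2:
  fixes H :: "'v horn set"
    and Sig :: "'f set"
    and ar :: "'f \<Rightarrow> nat"
    and \<Phi> :: "('f, 'x) geq set"
    and \<phi> :: "('f, 'x) geq"
  assumes H_wf: "\<forall>h\<in>H. horn_wf h"
    and universe: "\<exists>e :: ('f, 'x) trm \<Rightarrow> 'a. inj_on e (terms Sig ar UNIV)"
    and \<Phi>_GEq: "\<Phi> \<subseteq> GEq H Sig ar"
    and \<phi>_GEq: "\<phi> \<in> GEq H Sig ar"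
    and consequence: "entails TYPE('a) H Sig ar \<Phi> \<phi>"
  shows "derives H Sig ar \<Phi> \<phi>"
proof -
  obtain e :: "('f, 'x) trm \<Rightarrow> 'a" where e: "inj_on e (terms Sig ar UNIV)"
    using universe by blast
  \<comment> \<open>Injectivity on terms over all variables restricts to every \<open>X\<close>, so
    one \<open>e\<close> serves whatever context \<open>\<phi>\<close> turns out to have.\<close>
  have model: "term_model H Sig ar \<Phi> X d e" if "gmet H X d" for X d
    using H_wf \<Phi>_GEq that inj_on_subset[OF e terms_mono[OF subset_UNIV]] by unfold_locales
  have models: "models (term_model.\<AA> H Sig ar \<Phi> X d e) \<phi>" if "gmet H X d" for X d
    using consequence term_model.\<AA>_quantitative_algebra[OF model[OF that]]
      term_model.\<AA>_models[OF model[OF that]]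
    unfolding entails_def by blast
  show ?thesis
  proof (cases \<phi>)
    case (Eq X d s t)
    then have "gmet H X d" "s \<in> terms Sig ar X" "t \<in> terms Sig ar X"
      using \<phi>_GEq by (auto simp: GEq_def)
    then show ?thesis
      using term_model.models_Eq_derives[OF model] models Eq by blast
  next
    case (QEq X d r s t)
    then have "gmet H X d" "s \<in> terms Sig ar X" "t \<in> terms Sig ar X" "r \<in> {0..1}"
      using \<phi>_GEq by (auto simp: GEq_def)
    then show ?thesis
      using term_model.models_QEq_derives[OF model] models QEq by blast
  qed
qed

end
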